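(* Let $\upsilon\ge1$ be an integer, $q>-1$ and $p$ real, $s\ge0$ an integer with $s<\frac{p-1}{2}$, let $y_1\ne0$ and $y_2$ be real numbers, $w>b$, $t>a$ real, and let $\lambda,\mu\in\mathbb C$ with $\operatorname{Re}(\lambda)>0$, $\operatorname{Re}(\mu)>0$, $q+1>\operatorname{Re}(\lambda)$ and $p>\operatorname{Re}(\mu)+2s+1$. Then $$\left({}_wD_{b^+}^{\lambda}\;{}_tD_{a^+}^{\mu}\right)\left((t-a)^{p-s-1}(w-b)^q\;{}_KN_{s;\upsilon}^{(p,q)}\!\left(\frac{1}{y_1(t-a)},\,y_2(w-b)\right)\right)$$ $$=\frac{\Gamma(p-s)}{\Gamma(p-\mu-s)}\,(t-a)^{p-\mu-s-1}(w-b)^{q-\lambda}\;{}_KN_{s;\upsilon}^{(p-\mu,q-\lambda)}\!\left(\frac{1}{y_1(t-a)},\,y_2(w-b)\right).$$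
   Context: $(a)_n$ is the Pochhammer symbol. The first set of finite bivariate biorthogonal N-Konhauser polynomials is $${}_KN_{s;\upsilon}^{(p,q)}(t,w)=\Gamma(p-s)\sum_{k=0}^{s}\sum_{m=0}^{s-k}\frac{(-s)_{k+m}\,t^{s-k}w^{\upsilon m}}{\Gamma(p-2s+k)\,\Gamma(q+1+\upsilon m)\,k!\,m!},$$ the same formula being used for complex parameters. The Riemann–Liouville fractional integral in the variable $w$ is ${}_w\mathbb I_{b^+}^{\kappa}(f)(w)=\frac1{\Gamma(\kappa)}\int_b^w(w-\xi)^{\kappa-1}f(\xi)\,d\xi$ ($\operatorname{Re}(\kappa)>0$, $w>b$), and the Riemann–Liouville fractional derivative is ${}_wD_{b^+}^{\kappa}(f)=\left(\frac{d}{dw}\right)^{n}{}_w\mathbb I_{b^+}^{n-\kappa}(f)$ with $n=[\operatorname{Re}(\kappa)]+1$; ${}_tD_{a^+}^{\mu}$ is the same operator in the variable $t$ with base point $a$. *)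

theory Defs
  imports "HOL-Analysis.Analysis"
begin

text \<open>
  All parameters are complex, since the same formula is used for the shifted parameters
  \<open>p - \<mu>\<close> and \<open>q - \<lambda>\<close>; real data are embedded by \<^const>\<open>complex_of_real\<close>.
\<close>

definition KN :: "nat \<Rightarrow> nat \<Rightarrow> complex \<Rightarrow> complex \<Rightarrow> complex \<Rightarrow> complex \<Rightarrow> complex" where
  "KN s \<upsilon> p q t w =
     Gamma (p - of_nat s) *
       (\<Sum>k=0..s. \<Sum>m=0..s-k.
          pochhammer (- of_nat s) (k + m) * t ^ (s - k) * w ^ (\<upsilon> * m) /
          (Gamma (p - 2 * of_nat s + of_nat k) * Gamma (q + 1 + of_nat (\<upsilon> * m)) *
           fact k * fact m))"

text \<open>
  The operators act on complex-valued functions of a real variable.  They are intended for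
  \<open>Re \<kappa> > 0\<close> and arguments to the right of the base point \<open>b\<close>, where the powers of the positive
  reals \<open>x - \<xi>\<close> are principal ones.
\<close>

definition RL_integrand :: "complex \<Rightarrow> (real \<Rightarrow> complex) \<Rightarrow> real \<Rightarrow> real \<Rightarrow> complex" where
  "RL_integrand \<kappa> f x \<xi> = complex_of_real (x - \<xi>) powr (\<kappa> - 1) * f \<xi>"

definition RL_integral :: "real \<Rightarrow> complex \<Rightarrow> (real \<Rightarrow> complex) \<Rightarrow> real \<Rightarrow> complex" where
  "RL_integral b \<kappa> f x = 1 / Gamma \<kappa> * integral {b..x} (RL_integrand \<kappa> f x)"

definition iter_deriv :: "nat \<Rightarrow> (real \<Rightarrow> complex) \<Rightarrow> real \<Rightarrow> complex" where
  "iter_deriv n = (\<lambda>g x. vector_derivative g (at x)) ^^ n"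

definition RL_order :: "complex \<Rightarrow> nat" where
  "RL_order \<kappa> = nat (\<lfloor>Re \<kappa>\<rfloor> + 1)"

definition RL_derivative :: "real \<Rightarrow> complex \<Rightarrow> (real \<Rightarrow> complex) \<Rightarrow> real \<Rightarrow> complex" where
  "RL_derivative b \<kappa> f =
     iter_deriv (RL_order \<kappa>) (RL_integral b (of_nat (RL_order \<kappa>) - \<kappa>) f)"

text \<open>
  \<^const>\<open>integral\<close> and \<^const>\<open>vector_derivative\<close> are total functions, so an equation between values
  of \<^const>\<open>RL_derivative\<close> does not by itself say that the integral converges and that the
  derivatives exist.  The following predicate says so, at every point of \<open>(b, \<infinity>)\<close>.
\<close>

definition has_RL_derivative :: "real \<Rightarrow> complex \<Rightarrow> (real \<Rightarrow> complex) \<Rightarrow> bool" where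
  "has_RL_derivative b \<kappa> f \<longleftrightarrow>
     (\<forall>x>b. RL_integrand (of_nat (RL_order \<kappa>) - \<kappa>) f x absolutely_integrable_on {b..x}) \<and>
     (\<forall>x>b. \<forall>j<RL_order \<kappa>.
        iter_deriv j (RL_integral b (of_nat (RL_order \<kappa>) - \<kappa>) f) differentiable at x)"

end

theory Submission
  imports Defs
begin

text \<open>
  Everything rests on one family of functions, the powers
  \<open>\<Phi>\<^sub>z(x) = (x - b)\<^bsup>z - 1\<^esup> / \<Gamma>(z)\<close> normalised by a Gamma factor, on which fractional calculus
  acts by shifting the index.  For \<open>Re z > 0\<close> and \<open>Re \<delta> > 0\<close> the Riemann--Liouville integral of
  order \<open>\<delta>\<close> maps \<open>\<Phi>\<^sub>z\<close> to \<open>\<Phi>\<^bsub>z + \<delta>\<^esub>\<close>, which is the Beta integral in disguise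
  (\<open>RL_integrand_normalized_power\<close>).  An ordinary derivative maps \<open>\<Phi>\<^sub>z\<close> to \<open>\<Phi>\<^bsub>z - 1\<^esub>\<close>, because
  \<open>(z - 1) / \<Gamma>(z) = 1 / \<Gamma>(z - 1)\<close> (\<open>has_vector_derivative_normalized_power\<close>).  So the fractional
  derivative of order \<open>\<kappa>\<close>, an integral of order \<open>n - \<kappa>\<close> followed by \<open>n\<close> derivatives, maps
  \<open>\<Phi>\<^sub>z\<close> to \<open>\<Phi>\<^bsub>z - \<kappa>\<^esub>\<close>, and by linearity it acts in this way on every finite combination
  (\<open>RL_derivative_normalized_power_sum\<close>).

  The factors \<open>\<Gamma>(p - 2s + k)\<close> and \<open>\<Gamma>(q + 1 + \<upsilon>m)\<close> in the denominators of the polynomial are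
  exactly those normalisations: the weight times the polynomial, at
  \<open>1 / (y\<^sub>1 (t - a))\<close> and \<open>y\<^sub>2 (w - b)\<close>, equals \<open>\<Gamma>(p - s)\<close> times
  \<open>\<Sum> A\<^bsub>k,m\<^esub> \<Phi>\<^bsub>p - 2s + k\<^esub>(t) \<Phi>\<^bsub>q + 1 + \<upsilon>m\<^esub>(w)\<close>, with coefficients \<open>A\<^bsub>k,m\<^esub>\<close> in which neither
  \<open>p\<close> nor \<open>q\<close> occurs (\<open>weighted_KN_eq_normalized_power_sum\<close>).  Shifting the indices by \<open>\<mu>\<close> and
  \<open>\<lambda>\<close> is therefore the same as replacing \<open>p\<close> by \<open>p - \<mu>\<close> and \<open>q\<close> by \<open>q - \<lambda>\<close>, except in the
  prefactor \<open>\<Gamma>(p - s)\<close>; this accounts for the quotient of Gamma values in the result.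

  The complex Beta integral is obtained from \<open>\<Gamma>(\<alpha>) \<Gamma>(\<beta>)\<close>: the product of the two Gamma integrals is
  the integral of the convolution of their integrands, and scaling shows that this convolution is
  a constant multiple of the integrand of \<open>\<Gamma>(\<alpha> + \<beta>)\<close>, the constant being the Beta integral.
\<close>

section \<open>The Beta integral with complex parameters\<close>

lemma Gamma_nonzero_if_Re_pos:
  assumes "Re z > 0"
  shows   "Gamma z \<noteq> 0"
proof
  assume "Gamma z = 0"
  then obtain n where "z = of_int n" "n \<le> 0"
    by (auto simp: Gamma_eq_zero_iff elim!: nonpos_Ints_cases)
  with assms show False by simp
qed

text \<open>
  Since \<open>0 powr z = 0\<close>, the kernel vanishes at both ends of the interval, so it makes no
  difference whether the interval is open or closed.
\<close>

definition beta_kernel :: "complex \<Rightarrow> complex \<Rightarrow> real \<Rightarrow> real \<Rightarrow> real \<Rightarrow> complex" where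
  "beta_kernel \<alpha> \<beta> b x \<xi> = indicator {b..x} \<xi> *\<^sub>R
     (complex_of_real (x - \<xi>) powr (\<alpha> - 1) * complex_of_real (\<xi> - b) powr (\<beta> - 1))"

text \<open>The modulus of the kernel is the real Beta integrand with parameters \<open>Re \<beta>\<close> and \<open>Re \<alpha>\<close>.\<close>

lemma integrable_beta_kernel_01:
  assumes "Re \<alpha> > 0" "Re \<beta> > 0"
  shows   "integrable lborel (beta_kernel \<alpha> \<beta> 0 1)"
proof (rule Bochner_Integration.integrable_bound)
  show "integrable lborel (\<lambda>x. indicat_real {0..1} x *\<^sub>R (x powr (Re \<beta> - 1) * (1 - x) powr (Re \<alpha> - 1)))"
    using integrable_Beta[of "Re \<beta>" "Re \<alpha>"] assms by (simp add: set_integrable_def)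
  show "beta_kernel \<alpha> \<beta> 0 1 \<in> borel_measurable lborel"
  proof -
    have "beta_kernel \<alpha> \<beta> 0 1 = (\<lambda>\<xi>. indicator {0<..<1} \<xi> *\<^sub>R
            (complex_of_real (1 - \<xi>) powr (\<alpha> - 1) * complex_of_real (\<xi> - 0) powr (\<beta> - 1)))"
    proof
      fix \<xi> :: real
      consider "\<xi> = 0" | "\<xi> = 1" | "\<xi> \<in> {0<..<1}" | "\<xi> \<notin> {0..1}" by fastforce
      thus "beta_kernel \<alpha> \<beta> 0 1 \<xi> = indicator {0<..<1} \<xi> *\<^sub>R
              (complex_of_real (1 - \<xi>) powr (\<alpha> - 1) * complex_of_real (\<xi> - 0) powr (\<beta> - 1))"
        by cases (auto simp: beta_kernel_def)
    qed
    also have "\<dots> \<in> borel_measurable borel"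
      by (intro borel_measurable_continuous_on_indicator continuous_intros)
         (auto simp: complex_nonpos_Reals_iff)
    finally show ?thesis by simp
  qed
  show "AE x in lborel. norm (beta_kernel \<alpha> \<beta> 0 1 x) \<le>
     norm (indicat_real {0..1} x *\<^sub>R (x powr (Re \<beta> - 1) * (1 - x) powr (Re \<alpha> - 1)))"
  proof (intro AE_I2)
    fix x :: real
    show "norm (beta_kernel \<alpha> \<beta> 0 1 x) \<le>
      norm (indicat_real {0..1} x *\<^sub>R (x powr (Re \<beta> - 1) * (1 - x) powr (Re \<alpha> - 1)))"
    proof (cases "x \<in> {0..1}")
      case True
      hence "norm (complex_of_real (1 - x) powr (\<alpha> - 1)) = (1 - x) powr (Re \<alpha> - 1)"
            "norm (complex_of_real (x - 0) powr (\<beta> - 1)) = x powr (Re \<beta> - 1)"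
        by (simp_all add: norm_powr_real_powr del: of_real_diff)
      thus ?thesis
        unfolding beta_kernel_def norm_scaleR norm_mult by simp
    qed (simp add: beta_kernel_def)
  qed
qed

text \<open>
  Substitute \<open>\<xi> = b + (x - b) \<eta>\<close>.  The value of the integral over the unit interval is left open,
  as the lemma also serves to determine it.
\<close>

lemma has_bochner_integral_beta_kernel_scale:
  assumes "has_bochner_integral lborel (beta_kernel \<alpha> \<beta> 0 1) B" "b < x"
  shows   "has_bochner_integral lborel (beta_kernel \<alpha> \<beta> b x)
             (complex_of_real (x - b) powr (\<alpha> + \<beta> - 1) * B)"
proof -
  define c where "c = x - b"
  have c: "c > 0" using assms by (simp add: c_def)
  have eq: "beta_kernel \<alpha> \<beta> b x (b + c * \<eta>) =
          complex_of_real c powr (\<alpha> + \<beta> - 2) * beta_kernel \<alpha> \<beta> 0 1 \<eta>" for \<eta>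
  proof (cases "\<eta> \<in> {0..1}")
    case True
    have in_interval: "b + c * \<eta> \<in> {b..x}"
    proof -
      have "0 \<le> c * \<eta>" using True c by simp
      moreover have "c * \<eta> \<le> c * 1" using True c by (intro mult_left_mono) simp_all
      moreover have "x = b + c" by (simp add: c_def)
      ultimately show ?thesis unfolding atLeastAtMost_iff by linarith
    qed
    have "x - (b + c * \<eta>) = c * (1 - \<eta>)" by (simp add: c_def algebra_simps)
    hence "beta_kernel \<alpha> \<beta> b x (b + c * \<eta>) =
        complex_of_real (c * (1 - \<eta>)) powr (\<alpha> - 1) * complex_of_real (c * \<eta>) powr (\<beta> - 1)"
      using in_interval by (simp add: beta_kernel_def del: of_real_diff of_real_mult)
    also have "complex_of_real (c * (1 - \<eta>)) powr (\<alpha> - 1) =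
       of_real c powr (\<alpha> - 1) * of_real (1 - \<eta>) powr (\<alpha> - 1)"
      using powr_times_real[of "of_real c" "of_real (1 - \<eta>)" "\<alpha> - 1"] True c
      by (simp del: of_real_diff)
    also have "complex_of_real (c * \<eta>) powr (\<beta> - 1) =
       of_real c powr (\<beta> - 1) * of_real \<eta> powr (\<beta> - 1)"
      using powr_times_real[of "of_real c" "of_real \<eta>" "\<beta> - 1"] True c by simp
    also have "(of_real c powr (\<alpha> - 1) * complex_of_real (1 - \<eta>) powr (\<alpha> - 1)) *
          (of_real c powr (\<beta> - 1) * complex_of_real \<eta> powr (\<beta> - 1)) =
        (of_real c powr (\<alpha> - 1) * of_real c powr (\<beta> - 1)) *
          (complex_of_real (1 - \<eta>) powr (\<alpha> - 1) * complex_of_real \<eta> powr (\<beta> - 1))"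
      by (simp only: mult_ac)
    also have "complex_of_real c powr (\<alpha> - 1) * of_real c powr (\<beta> - 1) = of_real c powr (\<alpha> + \<beta> - 2)"
      unfolding powr_add[symmetric] by (rule arg_cong[where f = "\<lambda>z. _ powr z"]) simp
    also have "complex_of_real (1 - \<eta>) powr (\<alpha> - 1) * complex_of_real \<eta> powr (\<beta> - 1) =
        beta_kernel \<alpha> \<beta> 0 1 \<eta>"
      using True by (simp add: beta_kernel_def)
    finally show ?thesis .
  next
    case False
    have "b + c * \<eta> \<notin> {b..x}"
    proof
      assume "b + c * \<eta> \<in> {b..x}"
      hence "0 \<le> c * \<eta>" "c * \<eta> \<le> c * 1" by (auto simp: c_def)
      with c have "\<eta> \<in> {0..1}" 
        by (simp add: zero_le_mult_iff)
      with False show False by simp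
    qed
    with False show ?thesis by (simp add: beta_kernel_def)
  qed
  have "complex_of_real c powr (\<alpha> + \<beta> - 1) = of_real c powr (\<alpha> + \<beta> - 2 + 1)"
    by (rule arg_cong[where f = "\<lambda>z. _ powr z"]) simp
  also have "\<dots> = complex_of_real c powr (\<alpha> + \<beta> - 2) * of_real c"
    unfolding powr_add using c by simp
  finally have pow: "complex_of_real c powr (\<alpha> + \<beta> - 1) =
      complex_of_real c powr (\<alpha> + \<beta> - 2) * of_real c" .
  have val: "(complex_of_real c powr (\<alpha> + \<beta> - 1) * B) /\<^sub>R \<bar>c\<bar> = of_real c powr (\<alpha> + \<beta> - 2) * B"
    unfolding pow using c by (simp add: scaleR_conv_of_real)
  have "has_bochner_integral lborel (\<lambda>\<eta>. beta_kernel \<alpha> \<beta> b x (b + c * \<eta>))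
          ((complex_of_real c powr (\<alpha> + \<beta> - 1) * B) /\<^sub>R \<bar>c\<bar>)"
    unfolding eq val by (intro has_bochner_integral_mult_right assms(1))
  moreover have "c \<noteq> 0" using c by simp
  ultimately have "has_bochner_integral lborel (beta_kernel \<alpha> \<beta> b x)
      (complex_of_real c powr (\<alpha> + \<beta> - 1) * B)"
    by (blast intro: iffD2[OF lborel_has_bochner_integral_real_affine_iff])
  thus ?thesis by (simp only: c_def)
qed

lemma has_bochner_integral_Gamma:
  assumes "Re z > 0"
  shows   "has_bochner_integral lborel
             (\<lambda>u. indicator {0<..} u *\<^sub>R (complex_of_real u powr (z - 1) / of_real (exp u))) (Gamma z)"
proof -
  let ?g = "\<lambda>u. complex_of_real u powr (z - 1) / of_real (exp u)"
  have "(\<lambda>u. indicator {0<..} u *\<^sub>R ?g u) \<in> borel_measurable borel"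
    by (intro borel_measurable_continuous_on_indicator continuous_intros)
       (auto simp: complex_nonpos_Reals_iff)
  hence meas: "(\<lambda>u. indicator {0<..} u *\<^sub>R ?g u) \<in> borel_measurable lborel"
    by simp
  have "set_integrable lborel {0<..} ?g"
    using absolutely_integrable_Gamma_integral'[OF assms] integrable_completion[OF meas]
    by (simp add: set_integrable_def)
  moreover from set_borel_integral_eq_integral(2)[OF this] Gamma_integral_complex'[OF assms]
  have "(LINT u:{0<..}|lborel. ?g u) = Gamma z"
    by (simp add: integral_unique)
  ultimately show ?thesis
    by (simp add: has_bochner_integral_iff set_integrable_def set_lebesgue_integral_def)
qed

text \<open>Fubini's theorem and translation invariance.\<close>

lemma integral_convolution_eq_mult:
  fixes f g :: "real \<Rightarrow> complex"
  assumes "has_bochner_integral lborel f I" "has_bochner_integral lborel g J"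
  shows   "(LINT u|lborel. LINT t|lborel. f t * g (u - t)) = I * J"
proof -
  have f: "integrable lborel f" "integral\<^sup>L lborel f = I"
    and g: "integrable lborel g" "integral\<^sup>L lborel g = J"
    using assms by (simp_all add: has_bochner_integral_iff)
  have [measurable]: "f \<in> borel_measurable borel" "g \<in> borel_measurable borel"
    using f g by auto
  have sh: "integrable lborel (\<lambda>u. g (u - t))" "(LINT u|lborel. g (u - t)) = J" for t
    using lborel_integrable_real_affine[OF g(1), of 1 "-t"]
          lborel_integral_real_affine[of 1 g "-t"] g(2) by simp_all
  have shn: "(LINT u|lborel. norm (g (u - t))) = (LINT u|lborel. norm (g u))" for t
    using lborel_integral_real_affine[of 1 "\<lambda>u. norm (g u)" "-t"] by simp
  have "integrable (lborel \<Otimes>\<^sub>M lborel) (\<lambda>(t, u). f t * g (u - t))"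
  proof (rule lborel_pair.Fubini_integrable)
    show "(\<lambda>(t, u). f t * g (u - t)) \<in> borel_measurable (lborel \<Otimes>\<^sub>M lborel)"
      by measurable
    show "integrable lborel (\<lambda>t. LINT u|lborel. norm (case (t, u) of (t, u) \<Rightarrow> f t * g (u - t)))"
      using f(1) by (simp add: norm_mult shn)
    show "AE t in lborel. integrable lborel (\<lambda>u. case (t, u) of (t, u) \<Rightarrow> f t * g (u - t))"
      using sh(1) by simp
  qed
  from lborel_pair.Fubini_integral[OF this] show ?thesis
    by (simp add: sh f)
qed

lemma has_bochner_integral_beta_kernel:
  assumes "Re \<alpha> > 0" "Re \<beta> > 0" "b < x"
  shows   "has_bochner_integral lborel (beta_kernel \<alpha> \<beta> b x)
             (complex_of_real (x - b) powr (\<alpha> + \<beta> - 1) * Beta \<alpha> \<beta>)"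
proof -
  define B where "B = integral\<^sup>L lborel (beta_kernel \<alpha> \<beta> 0 1)"
  have B: "has_bochner_integral lborel (beta_kernel \<alpha> \<beta> 0 1) B"
    using integrable_beta_kernel_01[OF assms(1,2)] by (simp add: B_def has_bochner_integral_iff)
  define g where "g = (\<lambda>z u. indicator {0<..} u *\<^sub>R (complex_of_real u powr (z - 1) / of_real (exp u)))"
  have g: "has_bochner_integral lborel (g z) (Gamma z)" if "Re z > 0" for z
    unfolding g_def using that by (rule has_bochner_integral_Gamma)
  \<comment> \<open>The convolution of the two Gamma integrands is again a Gamma integrand, by scaling.\<close>
  have inner: "(LINT t|lborel. g \<beta> t * g \<alpha> (u - t)) = B * g (\<alpha> + \<beta>) u" for u
  proof (cases "u > 0")
    case True
    have "g \<beta> t * g \<alpha> (u - t) = beta_kernel \<alpha> \<beta> 0 u t / of_real (exp u)" for t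
    proof -
      have "complex_of_real (exp t) * of_real (exp (u - t)) = of_real (exp u)"
        by (simp flip: of_real_mult exp_add)
      thus ?thesis
        by (auto simp: g_def beta_kernel_def indicator_def not_less le_less simp del: of_real_diff)
    qed
    moreover have "has_bochner_integral lborel (\<lambda>t. beta_kernel \<alpha> \<beta> 0 u t / of_real (exp u))
        (complex_of_real (u - 0) powr (\<alpha> + \<beta> - 1) * B / of_real (exp u))"
      by (intro has_bochner_integral_divide has_bochner_integral_beta_kernel_scale B True)
    ultimately show ?thesis
      using True by (simp add: has_bochner_integral_iff g_def mult_ac)
  next
    case False
    hence 0: "g \<beta> t * g \<alpha> (u - t) = 0" for t by (auto simp: g_def indicator_def)
    show ?thesis unfolding 0 using False by (simp add: g_def)
  qed
  have "Gamma \<beta> * Gamma \<alpha> = (LINT u|lborel. LINT t|lborel. g \<beta> t * g \<alpha> (u - t))"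
    using integral_convolution_eq_mult[OF g[OF assms(2)] g[OF assms(1)]] by simp
  also have "\<dots> = B * Gamma (\<alpha> + \<beta>)"
    using g[of "\<alpha> + \<beta>"] assms by (simp add: inner has_bochner_integral_iff)
  finally have "B * Gamma (\<alpha> + \<beta>) = Gamma \<alpha> * Gamma \<beta>"
    by (metis mult.commute)
  moreover have "Gamma (\<alpha> + \<beta>) \<noteq> 0"
    using assms by (intro Gamma_nonzero_if_Re_pos) simp
  ultimately have "B = Beta \<alpha> \<beta>"
    unfolding Beta_def by (rule eq_divide_imp[rotated])
  with has_bochner_integral_beta_kernel_scale[OF B assms(3)] show ?thesis by simp
qed

section \<open>Normalised powers under fractional calculus\<close>

text \<open>
  The entire function \<^const>\<open>rGamma\<close> makes the index shifts hold without exception, also when a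
  derivative brings the index to a pole of \<^const>\<open>Gamma\<close>.
\<close>

definition normalized_power :: "real \<Rightarrow> complex \<Rightarrow> real \<Rightarrow> complex" where
  "normalized_power b z x = rGamma z * complex_of_real (x - b) powr (z - 1)"

text \<open>
  The integral is \<open>Beta \<delta> z = \<Gamma>(\<delta>) \<Gamma>(z) / \<Gamma>(z + \<delta>)\<close> times \<open>(x - b)\<^bsup>z + \<delta> - 1\<^esup> / \<Gamma>(z)\<close>: the
  factors \<open>\<Gamma>(z)\<close> cancel, and \<open>1 / \<Gamma>(z + \<delta>)\<close> is the right normalisation for the new power.
\<close>

lemma RL_integrand_normalized_power:
  assumes "Re \<delta> > 0" "Re z > 0" "b < x"
  shows   "RL_integrand \<delta> (normalized_power b z) x absolutely_integrable_on {b..x}"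
    and   "integral {b..x} (RL_integrand \<delta> (normalized_power b z) x) = Gamma \<delta> * normalized_power b (z + \<delta>) x"
proof -
  have kernel: "indicator {b..x} \<xi> *\<^sub>R RL_integrand \<delta> (normalized_power b z) x \<xi> =
          rGamma z * beta_kernel \<delta> z b x \<xi>" for \<xi>
    unfolding RL_integrand_def normalized_power_def beta_kernel_def scaleR_conv_of_real
    by (simp only: mult_ac)
  have "rGamma z * (complex_of_real (x - b) powr (\<delta> + z - 1) * Beta \<delta> z) =
          (rGamma z * Gamma z) * (Gamma \<delta> * normalized_power b (z + \<delta>) x)"
    unfolding normalized_power_def Beta_altdef add.commute[of z \<delta>] by (simp only: mult_ac)
  also have "rGamma z * Gamma z = 1"
    using Gamma_nonzero_if_Re_pos[OF assms(2)] by (simp add: rGamma_inverse_Gamma)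
  finally have val: "rGamma z * (complex_of_real (x - b) powr (\<delta> + z - 1) * Beta \<delta> z) =
           Gamma \<delta> * normalized_power b (z + \<delta>) x"
    by (simp only: mult_1_left)
  have hb: "has_bochner_integral lborel
      (\<lambda>\<xi>. indicator {b..x} \<xi> *\<^sub>R RL_integrand \<delta> (normalized_power b z) x \<xi>)
      (Gamma \<delta> * normalized_power b (z + \<delta>) x)"
    unfolding kernel val[symmetric]
    by (intro has_bochner_integral_mult_right has_bochner_integral_beta_kernel assms)
  hence si: "set_integrable lborel {b..x} (RL_integrand \<delta> (normalized_power b z) x)"
    unfolding set_integrable_def by (rule integrable.intros)
  from si show "RL_integrand \<delta> (normalized_power b z) x absolutely_integrable_on {b..x}"
    unfolding set_integrable_def
    by (subst integrable_completion[OF borel_measurable_has_bochner_integral[OF hb]])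
  show "integral {b..x} (RL_integrand \<delta> (normalized_power b z) x) =
          Gamma \<delta> * normalized_power b (z + \<delta>) x"
    using set_borel_integral_eq_integral(2)[OF si] has_bochner_integral_integral_eq[OF hb]
    unfolding set_lebesgue_integral_def by (rule trans[OF sym])
qed

text \<open>
  \<open>rGamma z * (z - 1) = rGamma (z - 1)\<close> absorbs the exponent that differentiation brings down.
\<close>

lemma has_vector_derivative_normalized_power:
  assumes "b < x"
  shows   "(normalized_power b z has_vector_derivative normalized_power b (z - 1) x) (at x)"
proof -
  have "((\<lambda>u. rGamma z * (u - of_real b) powr (z - 1)) has_field_derivative
          rGamma z * ((z - 1) * (of_real x - of_real b) powr (z - 1 - 1))) (at (complex_of_real x))"
    using assms by (auto intro!: derivative_eq_intros simp flip: of_real_diff)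
  from has_vector_derivative_real_field[OF this]
  have "((\<lambda>u. rGamma z * complex_of_real (u - b) powr (z - 1)) has_vector_derivative
          rGamma z * ((z - 1) * complex_of_real (x - b) powr (z - 1 - 1))) (at x)"
    by simp
  moreover have "rGamma z * (z - 1) = rGamma (z - 1)"
    using rGamma_plus1[of "z - 1"] by (simp add: mult.commute)
  ultimately show ?thesis
    by (simp add: normalized_power_def[abs_def] flip: mult.assoc)
qed

lemma Re_RL_order:
  assumes "Re \<kappa> > 0"
  shows   "Re (of_nat (RL_order \<kappa>) - \<kappa>) > 0"
proof -
  have "real (RL_order \<kappa>) = of_int (\<lfloor>Re \<kappa>\<rfloor> + 1)"
    using assms by (simp add: RL_order_def)
  thus ?thesis by simp
qed

text \<open>
  Taking \<open>x = b\<close> into the assumption on \<open>f\<close> lets the integrands agree on the whole of \<open>{b..x}\<close>;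
  in the application both sides are \<open>0\<close> at that point.
\<close>

context
  fixes b :: real and \<kappa> :: complex and I :: "'i set" and c z :: "'i \<Rightarrow> complex"
    and f :: "real \<Rightarrow> complex"
  assumes fin: "finite I" and \<kappa>: "Re \<kappa> > 0" and z: "\<And>i. i \<in> I \<Longrightarrow> Re (z i) > 0"
    and f: "\<And>x. x \<ge> b \<Longrightarrow> f x = (\<Sum>i\<in>I. c i * normalized_power b (z i) x)"
begin

lemma RL_integral_normalized_power_sum:
  assumes "x > b"
  defines "\<delta> \<equiv> of_nat (RL_order \<kappa>) - \<kappa>"
  shows   "RL_integrand \<delta> f x absolutely_integrable_on {b..x}"
    and   "RL_integral b \<delta> f x = (\<Sum>i\<in>I. c i * normalized_power b (z i + \<delta>) x)"
proof -
  have \<delta>: "Re \<delta> > 0" unfolding \<delta>_def by (rule Re_RL_order[OF \<kappa>])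
  have eq: "RL_integrand \<delta> f x \<xi> = (\<Sum>i\<in>I. c i * RL_integrand \<delta> (normalized_power b (z i)) x \<xi>)"
    if "\<xi> \<in> {b..x}" for \<xi>
    using that by (simp add: RL_integrand_def f sum_distrib_left mult_ac)
  have int: "RL_integrand \<delta> (normalized_power b (z i)) x absolutely_integrable_on {b..x}" if "i \<in> I" for i
    using RL_integrand_normalized_power(1) \<delta> z that assms by blast
  hence "(\<lambda>\<xi>. \<Sum>i\<in>I. c i * RL_integrand \<delta> (normalized_power b (z i)) x \<xi>) absolutely_integrable_on {b..x}"
    by (intro absolutely_integrable_sum fin set_integrable_mult_right)
  thus "RL_integrand \<delta> f x absolutely_integrable_on {b..x}"
    by (rule absolutely_integrable_spike[of _ _ "{}"]) (use eq in auto)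
  have "integral {b..x} (RL_integrand \<delta> f x) =
          integral {b..x} (\<lambda>\<xi>. \<Sum>i\<in>I. c i * RL_integrand \<delta> (normalized_power b (z i)) x \<xi>)"
    by (intro integral_cong eq)
  also have "\<dots> = (\<Sum>i\<in>I. c i * (Gamma \<delta> * normalized_power b (z i + \<delta>) x))"
    using int \<delta> z assms(1)
    by (subst integral_sum)
       (auto intro!: fin sum.cong integrable_on_mult_right
             simp: set_lebesgue_integral_eq_integral(1) RL_integrand_normalized_power(2))
  also have "\<dots> = Gamma \<delta> * (\<Sum>i\<in>I. c i * normalized_power b (z i + \<delta>) x)"
    by (simp add: sum_distrib_left mult_ac)
  finally show "RL_integral b \<delta> f x = (\<Sum>i\<in>I. c i * normalized_power b (z i + \<delta>) x)"
    using Gamma_nonzero_if_Re_pos[OF \<delta>] by (simp add: RL_integral_def)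
qed

text \<open>
  The closed form holds on all of \<open>(b, \<infinity>)\<close>, an open set, so each differentiation of it again yields
  a closed form there; the values that \<^const>\<open>RL_integral\<close> takes at or to the left of \<open>b\<close> never
  enter.
\<close>

lemma iter_deriv_RL_integral_normalized_power_sum:
  defines "\<delta> \<equiv> of_nat (RL_order \<kappa>) - \<kappa>"
  assumes "x > b"
  shows   "(iter_deriv j (RL_integral b \<delta> f) has_vector_derivative
             (\<Sum>i\<in>I. c i * normalized_power b (z i + \<delta> - of_nat (Suc j)) x)) (at x)"
    and   "iter_deriv j (RL_integral b \<delta> f) x = (\<Sum>i\<in>I. c i * normalized_power b (z i + \<delta> - of_nat j) x)"
proof -
  have deriv: "(g has_vector_derivative (\<Sum>i\<in>I. c i * normalized_power b (z i + \<delta> - of_nat (Suc j)) x)) (at x)"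
    if g: "\<And>x. x > b \<Longrightarrow> g x = (\<Sum>i\<in>I. c i * normalized_power b (z i + \<delta> - of_nat j) x)" and x: "x > b" for g j x
  proof (rule has_vector_derivative_transform_within_open[where S = "{b<..}"])
    show "((\<lambda>x. \<Sum>i\<in>I. c i * normalized_power b (z i + \<delta> - of_nat j) x) has_vector_derivative
            (\<Sum>i\<in>I. c i * normalized_power b (z i + \<delta> - of_nat (Suc j)) x)) (at x)"
      using has_vector_derivative_normalized_power[OF x, of "z i + \<delta> - of_nat j" for i]
      by (intro has_vector_derivative_sum has_vector_derivative_mult_right) (simp add: algebra_simps)
  qed (use g x in auto)
  have val: "iter_deriv j (RL_integral b \<delta> f) x = (\<Sum>i\<in>I. c i * normalized_power b (z i + \<delta> - of_nat j) x)"
    if "x > b" for j x using that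
  proof (induction j arbitrary: x)
    case 0
    thus ?case using RL_integral_normalized_power_sum(2) by (simp add: iter_deriv_def \<delta>_def)
  next
    case (Suc j)
    from vector_derivative_at[OF deriv[OF Suc.IH Suc.prems]] show ?case
      by (simp add: iter_deriv_def)
  qed
  show "iter_deriv j (RL_integral b \<delta> f) x = (\<Sum>i\<in>I. c i * normalized_power b (z i + \<delta> - of_nat j) x)"
    by (rule val[OF assms(2)])
  show "(iter_deriv j (RL_integral b \<delta> f) has_vector_derivative
             (\<Sum>i\<in>I. c i * normalized_power b (z i + \<delta> - of_nat (Suc j)) x)) (at x)"
    by (rule deriv[OF val assms(2)])
qed

lemma has_RL_derivative_normalized_power_sum: "has_RL_derivative b \<kappa> f"
  using RL_integral_normalized_power_sum(1) iter_deriv_RL_integral_normalized_power_sum(1)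
  by (auto simp: has_RL_derivative_def intro: differentiableI_vector)

lemma RL_derivative_normalized_power_sum:
  assumes "x > b"
  shows   "RL_derivative b \<kappa> f x = (\<Sum>i\<in>I. c i * normalized_power b (z i - \<kappa>) x)"
  using iter_deriv_RL_integral_normalized_power_sum(2)[OF assms, of "RL_order \<kappa>"]
  by (simp add: RL_derivative_def)

end

section \<open>The weighted polynomials as sums of normalised powers\<close>

text \<open>
  The part of each summand that does not change under a shift of \<open>p\<close> and \<open>q\<close>.
\<close>

definition KN_coeff :: "nat \<Rightarrow> nat \<Rightarrow> real \<Rightarrow> real \<Rightarrow> nat \<times> nat \<Rightarrow> complex" where
  "KN_coeff s \<upsilon> y1 y2 = (\<lambda>(k, m). pochhammer (- of_nat s :: complex) (k + m) *
     of_real (1 / y1) ^ (s - k) * of_real y2 ^ (\<upsilon> * m) / (fact k * fact m))"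

definition KN_indices :: "nat \<Rightarrow> (nat \<times> nat) set" where
  "KN_indices s = (SIGMA k:{0..s}. {0..s-k})"

lemma powr_times_power_inverse:
  assumes "r \<ge> 0"
  shows "complex_of_real r powr z * of_real (1 / r) ^ n = of_real r powr (z - of_nat n)"
  using assms by (cases "r = 0") (simp_all add: powr_diff powr_nat' power_divide field_simps)

lemma powr_times_power:
  assumes "r \<ge> 0"
  shows "complex_of_real r powr z * of_real r ^ n = of_real r powr (z + of_nat n)"
  using assms by (cases "r = 0") (simp_all add: powr_add powr_nat')

text \<open>
  The weights \<open>(t - a)\<^bsup>p - s - 1\<^esup>\<close> and \<open>(w - b)\<^bsup>q\<^esup>\<close> turn \<open>(t - a)\<^bsup>-(s - k)\<^esup>\<close> and \<open>(w - b)\<^bsup>\<upsilon>m\<^esup>\<close>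
  into powers with exponents \<open>p - 2s + k - 1\<close> and \<open>q + \<upsilon>m\<close>, which match the Gamma factors of the
  summand.  For complex \<open>p\<close> and \<open>q\<close> the identity covers both sides of the theorem.
\<close>

lemma weighted_KN_eq_normalized_power_sum:
  assumes "t \<ge> a" "w \<ge> b"
  shows "complex_of_real (t - a) powr (p - of_nat s - 1) * complex_of_real (w - b) powr q *
           KN s \<upsilon> p q (of_real (1 / (y1 * (t - a)))) (of_real (y2 * (w - b))) =
         Gamma (p - of_nat s) * (\<Sum>(k,m)\<in>KN_indices s. KN_coeff s \<upsilon> y1 y2 (k, m) *
           normalized_power a (p - 2 * of_nat s + of_nat k) t * normalized_power b (q + 1 + of_nat (\<upsilon> * m)) w)"
proof -
  let ?T = "complex_of_real (t - a)" and ?W = "complex_of_real (w - b)"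
  let ?x = "complex_of_real (1 / (y1 * (t - a)))" and ?y = "complex_of_real (y2 * (w - b))"
  have summand: "?T powr (p - of_nat s - 1) * ?W powr q *
       (pochhammer (- of_nat s) (k + m) * ?x ^ (s - k) * ?y ^ (\<upsilon> * m) /
          (Gamma (p - 2 * of_nat s + of_nat k) * Gamma (q + 1 + of_nat (\<upsilon> * m)) *
           fact k * fact m)) =
       KN_coeff s \<upsilon> y1 y2 (k, m) *
           normalized_power a (p - 2 * of_nat s + of_nat k) t * normalized_power b (q + 1 + of_nat (\<upsilon> * m)) w"
    if "k \<le> s" for k m
  proof -
    have T: "?T powr (p - 2 * of_nat s + of_nat k - 1) =
            ?T powr (p - of_nat s - 1) * of_real (1 / (t - a)) ^ (s - k)"
      using assms that by (subst powr_times_power_inverse) (simp_all add: of_nat_diff algebra_simps)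
    have W: "?W powr (q + 1 + of_nat (\<upsilon> * m) - 1) = ?W powr q * ?W ^ (\<upsilon> * m)"
      using assms by (subst powr_times_power) simp_all
    have x: "?x ^ (s - k) = of_real (1 / y1) ^ (s - k) * of_real (1 / (t - a)) ^ (s - k)"
      by (simp flip: power_mult_distrib)
    have y: "?y ^ (\<upsilon> * m) = of_real y2 ^ (\<upsilon> * m) * ?W ^ (\<upsilon> * m)"
      by (simp flip: power_mult_distrib)
    show ?thesis
      unfolding normalized_power_def T W x y KN_coeff_def rGamma_inverse_Gamma
      by (simp add: divide_inverse mult_ac)
  qed
  have "?T powr (p - of_nat s - 1) * ?W powr q * KN s \<upsilon> p q ?x ?y =
      Gamma (p - of_nat s) * (\<Sum>k=0..s. \<Sum>m=0..s-k. ?T powr (p - of_nat s - 1) * ?W powr q *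
        (pochhammer (- of_nat s) (k + m) * ?x ^ (s - k) * ?y ^ (\<upsilon> * m) /
          (Gamma (p - 2 * of_nat s + of_nat k) * Gamma (q + 1 + of_nat (\<upsilon> * m)) *
           fact k * fact m)))"
    unfolding KN_def sum_distrib_left[symmetric] by (simp only: mult_ac)
  also have "(\<Sum>k=0..s. \<Sum>m=0..s-k. ?T powr (p - of_nat s - 1) * ?W powr q *
        (pochhammer (- of_nat s) (k + m) * ?x ^ (s - k) * ?y ^ (\<upsilon> * m) /
          (Gamma (p - 2 * of_nat s + of_nat k) * Gamma (q + 1 + of_nat (\<upsilon> * m)) *
           fact k * fact m))) =
      (\<Sum>k=0..s. \<Sum>m=0..s-k. KN_coeff s \<upsilon> y1 y2 (k, m) *
        normalized_power a (p - 2 * of_nat s + of_nat k) t *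
        normalized_power b (q + 1 + of_nat (\<upsilon> * m)) w)"
    by (intro sum.cong refl summand) simp
  also have "\<dots> = (\<Sum>(k,m)\<in>KN_indices s. KN_coeff s \<upsilon> y1 y2 (k, m) *
        normalized_power a (p - 2 * of_nat s + of_nat k) t *
        normalized_power b (q + 1 + of_nat (\<upsilon> * m)) w)"
    unfolding KN_indices_def by (rule sum.Sigma) simp_all
  finally show ?thesis .
qed

section \<open>The mixed fractional derivative\<close>

theorem theorem35:
  fixes \<upsilon> s :: nat and p q y1 y2 a b t w :: real and lam mu :: complex
  assumes "\<upsilon> \<ge> 1"
    and "q > -1"
    and "real s < (p - 1) / 2"
    and "y1 \<noteq> 0"
    and "w > b" and "t > a"
    and "Re lam > 0" and "Re mu > 0"
    and "q + 1 > Re lam"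
    and "p > Re mu + 2 * real s + 1"
  shows
    "let F = (\<lambda>\<tau> \<omega>.
        complex_of_real (\<tau> - a) powr (of_real p - of_nat s - 1) *
        complex_of_real (\<omega> - b) powr (of_real q) *
        KN s \<upsilon> (of_real p) (of_real q)
          (of_real (1 / (y1 * (\<tau> - a)))) (of_real (y2 * (\<omega> - b))))
     in (\<forall>\<omega>>b. has_RL_derivative a mu (\<lambda>\<tau>. F \<tau> \<omega>)) \<and>
        has_RL_derivative b lam (\<lambda>\<omega>. RL_derivative a mu (\<lambda>\<tau>. F \<tau> \<omega>) t) \<and>
        RL_derivative b lam (\<lambda>\<omega>. RL_derivative a mu (\<lambda>\<tau>. F \<tau> \<omega>) t) w =
          Gamma (of_real p - of_nat s) / Gamma (of_real p - mu - of_nat s) *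
          complex_of_real (t - a) powr (of_real p - mu - of_nat s - 1) *
          complex_of_real (w - b) powr (of_real q - lam) *
          KN s \<upsilon> (of_real p - mu) (of_real q - lam)
            (of_real (1 / (y1 * (t - a)))) (of_real (y2 * (w - b)))"
proof -
  define F where "F = (\<lambda>\<tau> \<omega>.
        complex_of_real (\<tau> - a) powr (of_real p - of_nat s - 1) *
        complex_of_real (\<omega> - b) powr (of_real q) *
        KN s \<upsilon> (of_real p) (of_real q)
          (of_real (1 / (y1 * (\<tau> - a)))) (of_real (y2 * (\<omega> - b))))"
  define A where "A = (\<lambda>i. Gamma (of_real p - of_nat s) * KN_coeff s \<upsilon> y1 y2 i)"
  define zt where "zt = (\<lambda>i::nat\<times>nat. complex_of_real p - 2 * of_nat s + of_nat (fst i))"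
  define zw where "zw = (\<lambda>i::nat\<times>nat. complex_of_real q + 1 + of_nat (\<upsilon> * snd i))"
  define G where "G = (\<lambda>\<omega>. RL_derivative a mu (\<lambda>\<tau>. F \<tau> \<omega>) t)"
  have fin: "finite (KN_indices s)" by (simp add: KN_indices_def)
  have Re_zt: "Re (zt i) > 0" for i
    using assms by (simp add: zt_def)
  have Re_zw: "Re (zw i) > 0" for i
    using assms by (simp add: zw_def add_pos_nonneg)
  \<comment> \<open>With one variable held fixed, its normalised power becomes part of the coefficient.\<close>
  have F: "F \<tau> \<omega> = (\<Sum>i\<in>KN_indices s. (A i * normalized_power b (zw i) \<omega>) * normalized_power a (zt i) \<tau>)"
    if "\<tau> \<ge> a" "\<omega> \<ge> b" for \<tau> \<omega>
    unfolding F_def weighted_KN_eq_normalized_power_sum[OF that] sum_distrib_left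
    by (intro sum.cong) (auto simp: A_def zt_def zw_def mult_ac)
  have G: "G \<omega> = (\<Sum>i\<in>KN_indices s. (A i * normalized_power a (zt i - mu) t) * normalized_power b (zw i) \<omega>)"
    if "\<omega> \<ge> b" for \<omega>
    unfolding G_def
    using RL_derivative_normalized_power_sum[OF fin \<open>Re mu > 0\<close> Re_zt F[OF _ that] \<open>t > a\<close>]
    by (simp add: mult_ac)
  have "has_RL_derivative a mu (\<lambda>\<tau>. F \<tau> \<omega>)" if "\<omega> > b" for \<omega>
    using has_RL_derivative_normalized_power_sum[OF fin \<open>Re mu > 0\<close> Re_zt F] that by simp
  moreover have "has_RL_derivative b lam G"
    by (rule has_RL_derivative_normalized_power_sum[OF fin \<open>Re lam > 0\<close> Re_zw G])
  moreover have "RL_derivative b lam G w =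
      (\<Sum>i\<in>KN_indices s. (A i * normalized_power a (zt i - mu) t) * normalized_power b (zw i - lam) w)"
    by (rule RL_derivative_normalized_power_sum[OF fin \<open>Re lam > 0\<close> Re_zw G \<open>w > b\<close>])
  moreover have "\<dots> =
          Gamma (of_real p - of_nat s) / Gamma (of_real p - mu - of_nat s) *
          (complex_of_real (t - a) powr (of_real p - mu - of_nat s - 1) *
          complex_of_real (w - b) powr (of_real q - lam) *
          KN s \<upsilon> (of_real p - mu) (of_real q - lam)
            (of_real (1 / (y1 * (t - a)))) (of_real (y2 * (w - b))))"
  proof -
    have "Gamma (of_real p - mu - of_nat s) \<noteq> 0"
    proof -
      show ?thesis using assms by (intro Gamma_nonzero_if_Re_pos) simp
    qed
    thus ?thesis
      using assms by (subst weighted_KN_eq_normalized_power_sum)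
        (auto simp: A_def zt_def zw_def sum_distrib_left algebra_simps intro!: sum.cong)
  qed
  ultimately show ?thesis
    unfolding Let_def F_def[symmetric] G_def[symmetric] by (simp add: mult.assoc)
qed

end
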